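(* Let $a,b,c,d\in\mathbb{R}$ with $ad-bc=1$ and $b\ne0$, and write $A=(a,b,c,d)$. Let $p\in[1,\infty)$, $B>0$ and $m\in\left(0,\frac{1}{4B}\right)$. Then the following are equivalent for $f,g\in L^p([-B,B])$: (1) $f=e^{i\alpha}g$ for some $\alpha\in\mathbb{R}$; (2) $|\mathcal{G}^{(A)}f|=|\mathcal{G}^{(A)}g|$ on $\mathbb{N}\times mb\mathbb{Z}$.
   Context: Functions in $L^p([-B,B])$ are extended by zero to $\mathbb{R}$. With the Gaussian window $\varphi(t)=e^{-t^2}$, $\mathcal{G}^{(A)}f:=V_\varphi^{(A)}f$ is the short-time linear canonical transform $$\mathcal{G}^{(A)}f(x,\mu)=\frac{1}{\sqrt b}\int_{\mathbb{R}}e^{i\left(\frac{a}{2b}t^2-\frac1b t\mu+\frac{d}{2b}\mu^2\right)}\,\overline{\varphi(t-x)}\,f(t)\,dt,\qquad x,\mu\in\mathbb{R}.$$ The set $\mathbb{N}\times mb\mathbb{Z}$ consists of the points $(x,\mu)$ with $x\in\mathbb{N}$ and $\mu=mbk$, $k\in\mathbb{Z}$. *)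

theory Defs
  imports "HOL-Analysis.Analysis"
begin

(* Representatives of the classes in L^p(S), with respect to Lebesgue measure; equality in L^p(S)
   is equality almost everywhere on S. *)
definition Lp_on :: "real \<Rightarrow> real set \<Rightarrow> (real \<Rightarrow> complex) set" where
  "Lp_on p S = {f. set_borel_measurable lebesgue S f \<and>
                   set_integrable lebesgue S (\<lambda>t. norm (f t) powr p)}"

definition zero_ext :: "real set \<Rightarrow> (real \<Rightarrow> complex) \<Rightarrow> real \<Rightarrow> complex" where
  "zero_ext S f t = (if t \<in> S then f t else 0)"

(* The complex principal root csqrt is used since b may be negative. *)
definition stlct ::
  "(real \<Rightarrow> complex) \<Rightarrow> real \<times> real \<times> real \<times> real \<Rightarrow> (real \<Rightarrow> complex) \<Rightarrow> real \<Rightarrow> real \<Rightarrow> complex" where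
  "stlct \<phi> A f x \<mu> = (case A of (a, b, c, d) \<Rightarrow>
     1 / csqrt (of_real b) *
     (LINT t|lebesgue.
        exp (\<i> * of_real (a / (2 * b) * t\<^sup>2 - 1 / b * t * \<mu> + d / (2 * b) * \<mu>\<^sup>2))
        * cnj (\<phi> (t - x)) * f t))"

definition gauss_window :: "real \<Rightarrow> complex" where
  "gauss_window t = of_real (exp (- t\<^sup>2))"

definition gabor_lct ::
  "real \<times> real \<times> real \<times> real \<Rightarrow> (real \<Rightarrow> complex) \<Rightarrow> real \<Rightarrow> real \<Rightarrow> complex" where
  "gabor_lct A f = stlct gauss_window A f"

end

theory Submission
  imports Defs
begin

text \<open>
  Up to unimodular and constant factors the sample at \<open>(n, m b k)\<close> is the integral of
  \<open>exp (2 n t - i m k t)\<close> against \<open>h t = exp (i a t^2 / (2 b) - t^2) f t\<close>, and its squared modulus is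
  the double integral of \<open>exp (2 n (x + y) - i m k (x - y))\<close> against \<open>h x * cnj (h y)\<close>. These
  exponentials are closed under products and conjugation and, as \<open>4 B m < 2 \<pi>\<close>, separate the points
  of the square, so by Stone--Weierstrass the samples determine the integral of every continuous
  function against \<open>h x * cnj (h y)\<close>. Testing with products \<open>\<phi> x * \<psi> y\<close> and fixing a good \<open>\<psi>\<close>
  recovers \<open>h\<close> up to a unimodular constant.
\<close>

section \<open>Measure theory: continuous test functions and product integrals\<close>

text \<open>The cutoffs \<open>\<phi> n\<close> are bounded by 1 and converge pointwise to the
  indicator of a nonempty closed set, so dominated convergence makes the integral of
  \<open>h\<close> vanish on closed sets. These form an intersection-stable generator of the Borel
  sets, and a Dynkin system argument carries the vanishing to all Borel sets.\<close>

lemma AE_zero_if_continuous_tests_zero: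
  fixes h :: "'a::euclidean_space \<Rightarrow> 'b::{second_countable_topology,banach}"
  assumes h: "integrable lborel h"
    and test: "\<And>\<phi>::'a \<Rightarrow> real. continuous_on UNIV \<phi> \<Longrightarrow> (LINT x|lborel. \<phi> x *\<^sub>R h x) = 0"
  shows "AE x in lborel. h x = 0"
proof -
  have closed: "(LINT x:C|lborel. h x) = 0" if C: "closed C" for C
  \<comment> \<open>The empty set is separate because \<open>infdist x {}\<close> is 0 by
    convention, which would make every cutoff constantly 1.\<close>
  proof (cases "C = {}")
    case False
    define \<phi> where "\<phi> n x = max 0 (1 - real n * infdist x C)" for n x
    have cont: "continuous_on UNIV (\<phi> n)" for n
      unfolding \<phi>_def by (intro continuous_intros)
    have lim: "(\<lambda>n. \<phi> n x) \<longlonglongrightarrow> indicator C x" for x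
    proof (cases "x \<in> C")
      case True
      then show ?thesis by (simp add: \<phi>_def)
    next
      case x: False
      then have pos: "infdist x C > 0" using C False infdist_pos_not_in_closed by blast
      have "eventually (\<lambda>n. real n * infdist x C \<ge> 1) sequentially"
      proof (rule eventually_sequentiallyI)
        fix n assume "nat \<lceil>1 / infdist x C\<rceil> \<le> n"
        then show "real n * infdist x C \<ge> 1"
          using pos by (simp add: divide_le_eq nat_le_iff ceiling_le_iff)
      qed
      then have "eventually (\<lambda>n. \<phi> n x = 0) sequentially"
        by eventually_elim (simp add: \<phi>_def)
      then show ?thesis using x by (simp add: tendsto_eventually)
    qed
    have bnd: "\<bar>\<phi> n x\<bar> \<le> 1" for n x
      using infdist_nonneg[of x C] by (simp add: \<phi>_def max_def)
    have [measurable]: "\<phi> n \<in> borel_measurable borel" for n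
      using borel_measurable_continuous_onI[OF cont] .
    have [measurable]: "h \<in> borel_measurable borel" "C \<in> sets borel" 
      using h C by auto
    have "(\<lambda>n. LINT x|lborel. \<phi> n x *\<^sub>R h x) \<longlonglongrightarrow> (LINT x|lborel. indicator C x *\<^sub>R h x)"
      by (rule integral_dominated_convergence[where w="\<lambda>x. norm (h x)"])
        (use h bnd lim in \<open>auto intro!: tendsto_scaleR mult_left_le_one_le\<close>)
    then show ?thesis
      by (simp add: test[OF cont] set_lebesgue_integral_def LIMSEQ_const_iff)
  qed (simp add: set_lebesgue_integral_def)
  have int: "set_integrable lborel A h" if "A \<in> sets borel" for A
    using h that by (simp add: set_integrable_def integrable_mult_indicator)
  have stable: "Int_stable (Collect closed :: 'a set set)" by (auto simp: Int_stable_def)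
  have "(LINT x:A|lborel. h x) = 0" if "A \<in> sigma_sets UNIV (Collect closed)" for A
    using stable subset_UNIV[of "Collect closed", folded Pow_UNIV] that
  proof (induction rule: sigma_sets_induct_disjoint)
    case (basic A)
    then show ?case using closed by simp
  next
    case (compl A)
    then have A: "A \<in> sets borel" by (simp add: borel_eq_closed)
    have "(LINT x:UNIV|lborel. h x) = (LINT x:A|lborel. h x) + (LINT x:UNIV - A|lborel. h x)"
      using set_integral_Un[of A "UNIV - A" lborel h] A by (simp add: int)
    then show ?case using compl closed[of UNIV] by simp
  next
    case (union A)
    then have "A i \<in> sets borel" for i by (auto simp: borel_eq_closed)
    then show ?case using union
      by (subst lebesgue_integral_countable_add) (auto simp: disjoint_family_on_def intro!: int)
  qed (simp_all add: set_lebesgue_integral_def)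
  then have "(LINT x:A|lborel. h x) = 0" if "A \<in> sets lborel" for A
    using that by (simp add: borel_eq_closed)
  then show ?thesis
    using sigma_finite_measure.density_zero[OF sigma_finite_lborel h] by blast
qed

lemma
  fixes h :: "'a::euclidean_space \<Rightarrow> 'c::{second_countable_topology,banach,real_normed_field}"
    and h' :: "'b::euclidean_space \<Rightarrow> 'c"
  assumes h: "integrable lborel h" and h': "integrable lborel h'"
  shows integrable_tensor_lborel: "integrable lborel (\<lambda>z. h (fst z) * h' (snd z))"
    and integral_tensor_lborel:
      "(LINT z|lborel. h (fst z) * h' (snd z)) = (LINT x|lborel. h x) * (LINT y|lborel. h' y)"
proof -
  have [measurable]: "h \<in> borel_measurable borel" "h' \<in> borel_measurable borel"
    using h h' by auto
  have *: "integrable (lborel \<Otimes>\<^sub>M lborel) (\<lambda>z. h (fst z) * h' (snd z))"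
    by (rule lborel_pair.Fubini_integrable) (use h h' in \<open>auto simp: norm_mult\<close>)
  then show "integrable lborel (\<lambda>z. h (fst z) * h' (snd z))"
    by (simp add: lborel_prod)
  show "(LINT z|lborel. h (fst z) * h' (snd z)) = (LINT x|lborel. h x) * (LINT y|lborel. h' y)"
    using lborel_pair.integral_fst'[OF *] h h' by (simp add: lborel_prod)
qed

text \<open>Multipliers such as real exponentials are unbounded on the whole space, but bounded on
  the compact set that carries \<open>h\<close>; this gives an integrable majorant.\<close>

lemma integrable_continuous_mult_compact:
  fixes h q :: "'a::euclidean_space \<Rightarrow> 'c::{second_countable_topology,banach,real_normed_field}"
  assumes h: "integrable lborel h" and S: "compact S" "\<And>x. x \<notin> S \<Longrightarrow> h x = 0"
    and q: "continuous_on UNIV q"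
  shows "integrable lborel (\<lambda>x. q x * h x)"
proof -
  have "bounded (q ` S)"
    using S q by (meson compact_continuous_image compact_imp_bounded continuous_on_subset subset_UNIV)
  then obtain C where C: "\<And>x. x \<in> S \<Longrightarrow> norm (q x) \<le> C"
    by (auto simp: bounded_iff)
  have [measurable]: "h \<in> borel_measurable borel" "q \<in> borel_measurable borel"
    using h q by (auto intro: borel_measurable_continuous_onI)
  show ?thesis
  proof (rule Bochner_Integration.integrable_bound[where f="\<lambda>x. of_real C * h x"])
    show "AE x in lborel. norm (q x * h x) \<le> norm (of_real C * h x)"
    proof (rule AE_I2)
      fix x show "norm (q x * h x) \<le> norm (of_real C * h x)"
        using C[of x] S(2)[of x]
        by (cases "x \<in> S") (auto simp: norm_mult intro!: mult_right_mono)
    qed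
  qed (use h in auto)
qed

section \<open>Density of the exponentials on the square\<close>

lemma sin_cos_inj:
  fixes x y :: real
  assumes "sin x = sin y" "cos x = cos y" "\<bar>x - y\<bar> < 2 * pi"
  shows "x = y"
proof -
  obtain n :: int where n: "x = y + 2 * pi * n"
    using sin_cos_eq_iff[of x y] assms by auto
  then have "2 * pi * \<bar>real_of_int n\<bar> < 2 * pi * 1" using assms(3) by (simp add: abs_mult)
  then have "\<bar>real_of_int n\<bar> < 1" by (subst (asm) mult_less_cancel_left_pos) auto
  then have "n = 0" by linarith
  then show ?thesis using n by simp
qed

text \<open>In the application \<open>K\<close> is the difference of the kernels
  \<open>h x * cnj (h y)\<close> of two functions with equal samples. Multipliers that preserve the
  orthogonality relations are uniformly dense on the square, and a uniformly small error has a small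
  integral against the integrable \<open>e 1 0 z * K z\<close>.\<close>

lemma integral_continuous_mult_eq_0:
  fixes K :: "real \<times> real \<Rightarrow> complex" and m B :: real
  defines "e \<equiv> \<lambda>(n::nat) (k::int) z. exp (of_real (2 * real n * (fst z + snd z))
                        - \<i> * of_real (m * of_int k * (fst z - snd z)))"
  assumes K: "integrable lborel K" "\<And>z. z \<notin> {-B..B} \<times> {-B..B} \<Longrightarrow> K z = 0"
    and m: "0 < m" "m * (4 * B) < 2 * pi"
    and ortho: "\<And>n k. 1 \<le> n \<Longrightarrow> (LINT z|lborel. e n k z * K z) = 0"
    and f: "continuous_on UNIV (f :: real \<times> real \<Rightarrow> real)"
  shows "(LINT z|lborel. of_real (f z) * K z) = 0"
proof -
  define S where "S = {-B..B} \<times> {-B..B}"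
  have S: "compact S" by (simp add: S_def compact_Times)
  have [continuous_intros]: "continuous_on UNIV (e n k)" for n k
    unfolding e_def by (intro continuous_intros)
  have int: "integrable lborel (\<lambda>z. q z * K z)" if "continuous_on UNIV q" for q
    using integrable_continuous_mult_compact[OF K(1) S _ that] K(2) by (simp add: S_def)
  \<comment> \<open>The multipliers \<open>P\<close> of the space \<open>V\<close> form an algebra by construction, and this algebra
    contains the exponentials; no explicit description of their span is needed.\<close>
  define V where "V \<psi> \<longleftrightarrow> continuous_on UNIV \<psi> \<and>
      (\<forall>n k. 1 \<le> n \<longrightarrow> (LINT z|lborel. \<psi> z * e n k z * K z) = 0)" for \<psi> :: "real \<times> real \<Rightarrow> complex"
  define P where "P u \<longleftrightarrow> continuous_on UNIV u \<and> (\<forall>\<psi>. V \<psi> \<longrightarrow> V (\<lambda>z. of_real (u z) * \<psi> z))"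
    for u :: "real \<times> real \<Rightarrow> real"
  have V_one: "V (\<lambda>_. 1)" using ortho by (simp add: V_def)
  have V_add: "V (\<lambda>z. \<psi> z + \<theta> z)" if "V \<psi>" "V \<theta>" for \<psi> \<theta>
  proof -
    have "(LINT z|lborel. (\<psi> z + \<theta> z) * e n k z * K z) =
        (LINT z|lborel. \<psi> z * e n k z * K z) + (LINT z|lborel. \<theta> z * e n k z * K z)" for n k
      using that unfolding V_def distrib_right
      by (intro Bochner_Integration.integral_add int continuous_intros) auto
    then show ?thesis using that by (auto simp: V_def intro!: continuous_intros)
  qed
  have V_scale: "V (\<lambda>z. c * \<psi> z)" if "V \<psi>" for \<psi> c
    using that by (auto simp: V_def mult.assoc intro!: continuous_intros)
  have P_add: "P (\<lambda>z. u z + v z)" if "P u" "P v" for u v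
    using that V_add by (auto simp: P_def distrib_right intro!: continuous_intros)
  have P_mult: "P (\<lambda>z. u z * v z)" if "P u" "P v" for u v
    using that by (auto simp: P_def mult.assoc intro!: continuous_intros)
  have P_const: "P (\<lambda>z. c)" for c
    using V_scale by (auto simp: P_def)
  \<comment> \<open>Multiplying by \<open>e j l\<close> only shifts the indices, and
    \<open>j + n\<close> stays at least 1. Hence \<open>j = 0\<close> is allowed here, although
    orthogonality to \<open>e 0 k\<close> itself is not assumed; the sine and cosine below come from
    \<open>j = 0\<close>.\<close>
  have V_e: "V (\<lambda>z. e j l z * \<psi> z)" if "V \<psi>" for \<psi> j l
  proof -
    have shift: "(\<lambda>z. e j l z * \<psi> z * e n k z * K z) = (\<lambda>z. \<psi> z * e (j + n) (l + k) z * K z)" for n k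
      by (rule ext) (simp add: e_def exp_add[symmetric] algebra_simps)
    show ?thesis using that unfolding V_def shift by (auto intro!: continuous_intros)
  qed
  have V_eq: "V \<psi>'" if "V \<psi>" "\<And>z. \<psi>' z = \<psi> z" for \<psi> \<psi>'
    using that by presburger
  have P_exp: "P (\<lambda>z. exp (2 * (fst z + snd z)))"
    unfolding P_def
  proof (intro conjI allI impI)
    fix \<psi> assume "V \<psi>"
    from V_e[OF this, of 1 0] show "V (\<lambda>z. of_real (exp (2 * (fst z + snd z))) * \<psi> z)"
      by (rule V_eq) (simp add: e_def flip: exp_of_real)
  qed (intro continuous_intros)
  have cis: "e 0 1 z = cis (- (m * (fst z - snd z)))" "e 0 (-1) z = cis (m * (fst z - snd z))" for z
    by (simp_all add: e_def cis_conv_exp)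
  \<comment> \<open>Stone--Weierstrass is applied to real functions, so the unimodular exponentials
    enter through Euler's formulas. The space \<open>V\<close> is complex linear, which permits the
    coefficients involving \<open>\<i>\<close>.\<close>
  have cos_mult: "of_real (cos \<theta>) * w = 1/2 * (cis (-\<theta>) * w + cis \<theta> * w)"
    and sin_mult: "of_real (sin \<theta>) * w = \<i>/2 * (cis (-\<theta>) * w) + - \<i>/2 * (cis \<theta> * w)" for \<theta> w
    by (simp_all add: complex_eq_iff field_simps)
  have P_cos: "P (\<lambda>z. cos (m * (fst z - snd z)))"
    unfolding P_def
  proof (intro conjI allI impI)
    fix \<psi> assume "V \<psi>"
    from V_scale[OF V_add[OF V_e[OF this, of 0 1] V_e[OF this, of 0 "-1"]], of "1/2"]
    show "V (\<lambda>z. of_real (cos (m * (fst z - snd z))) * \<psi> z)"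
      by (rule V_eq) (simp only: cis cos_mult)
  qed (intro continuous_intros)
  have P_sin: "P (\<lambda>z. sin (m * (fst z - snd z)))"
    unfolding P_def
  proof (intro conjI allI impI)
    fix \<psi> assume \<psi>: "V \<psi>"
    from V_add[OF V_scale[OF V_e[OF \<psi>, of 0 1], of "\<i>/2"] V_scale[OF V_e[OF \<psi>, of 0 "-1"], of "-\<i>/2"]]
    show "V (\<lambda>z. of_real (sin (m * (fst z - snd z))) * \<psi> z)"
      by (rule V_eq) (simp only: cis sin_mult)
  qed (intro continuous_intros)
  \<comment> \<open>The real exponential determines the sum of the coordinates; sine and cosine
    determine \<open>m\<close> times their difference modulo 2 pi.\<close>
  have sep: "\<exists>u. P u \<and> u z \<noteq> u w" if zw: "z \<in> S" "w \<in> S" "z \<noteq> w" for z w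
  proof (rule ccontr)
    assume "\<not> ?thesis"
    then have eq: "u z = u w" if "P u" for u using that by blast
    have sum: "fst z + snd z = fst w + snd w"
      using eq[OF P_exp] by simp
    \<comment> \<open>Coordinate differences on the square lie in \<open>{-2*B..2*B}\<close>, so two
      of them are at most \<open>4 * B\<close> apart. The bound on \<open>m\<close> then excludes a
      nonzero multiple of the period.\<close>
    have "\<bar>(fst z - snd z) - (fst w - snd w)\<bar> \<le> 4 * B"
      using zw by (auto simp: S_def)
    then have "m * \<bar>(fst z - snd z) - (fst w - snd w)\<bar> \<le> m * (4 * B)"
      using m by (intro mult_left_mono) auto
    then have "m * \<bar>(fst z - snd z) - (fst w - snd w)\<bar> < 2 * pi" using m(2) by linarith
    then have "\<bar>m * (fst z - snd z) - m * (fst w - snd w)\<bar> < 2 * pi"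
      using m(1) by (simp add: abs_mult flip: right_diff_distrib)
    then have "m * (fst z - snd z) = m * (fst w - snd w)"
      by (rule sin_cos_inj[OF eq[OF P_sin] eq[OF P_cos]])
    then have "fst z - snd z = fst w - snd w" using m by simp
    with sum have "z = w" by (simp add: prod_eq_iff)
    then show False using zw by simp
  qed
  \<comment> \<open>Orthogonality is only known for \<open>n \<ge> 1\<close>, so the factor \<open>e 1 0\<close> is divided out first.\<close>
  define F where "F z = f z * exp (- 2 * (fst z + snd z))" for z
  have F: "continuous_on UNIV F" unfolding F_def by (intro continuous_intros f)
  have F_e: "of_real (F z) * e 1 0 z = of_real (f z)" for z
  proof -
    have "e 1 0 z = of_real (exp (2 * (fst z + snd z)))" by (simp add: e_def flip: exp_of_real)
    then have "of_real (F z) * e 1 0 z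
        = of_real (f z * (exp (- 2 * (fst z + snd z)) * exp (2 * (fst z + snd z))))"
      by (simp only: F_def of_real_mult mult.assoc)
    also have "exp (- 2 * (fst z + snd z)) * exp (2 * (fst z + snd z)) = 1"
      by (simp flip: exp_add)
    finally show ?thesis by simp
  qed
  \<comment> \<open>This constant does not depend on the approximant, so the estimate below survives
    the limit in \<open>\<epsilon>\<close>.\<close>
  define C where "C = (LINT z|lborel. norm (e 1 0 z * K z))"
  have "norm (LINT z|lborel. of_real (f z) * K z) \<le> \<epsilon> * C" if \<epsilon>: "\<epsilon> > 0" for \<epsilon>
  proof -
    have "\<exists>u. P u \<and> (\<forall>z\<in>S. \<bar>F z - u z\<bar> < \<epsilon>)"
    proof (rule Stone_Weierstrass_HOL[where P=P])
      show "continuous_on S F" using F continuous_on_subset by blast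
      show "continuous_on S u" if "P u" for u
        using that unfolding P_def by (meson continuous_on_subset subset_UNIV)
    qed (use S \<epsilon> sep P_const P_add P_mult in blast)+
    then obtain u where u: "P u" "\<And>z. z \<in> S \<Longrightarrow> \<bar>F z - u z\<bar> < \<epsilon>" by blast
    have uc: "continuous_on UNIV u" using u by (simp add: P_def)
    \<comment> \<open>Applying the multiplier \<open>u\<close> to the constant 1 and reading off the
      relation for \<open>n = 1\<close>, \<open>k = 0\<close> gives exactly the integral to be
      subtracted.\<close>
    have "V (\<lambda>z. of_real (u z) * 1)" using u V_one unfolding P_def by blast
    then have "(LINT z|lborel. of_real (u z) * e 1 0 z * K z) = 0" by (simp add: V_def)
    then have "(LINT z|lborel. of_real (f z) * K z)
       = (LINT z|lborel. of_real (F z) * e 1 0 z * K z) - (LINT z|lborel. of_real (u z) * e 1 0 z * K z)"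
      by (simp only: F_e diff_zero)
    also have "\<dots> = (LINT z|lborel. of_real (F z) * e 1 0 z * K z - of_real (u z) * e 1 0 z * K z)"
      by (rule Bochner_Integration.integral_diff[symmetric])
        (intro int continuous_intros F uc)+
    also have "\<dots> = (LINT z|lborel. of_real (F z - u z) * e 1 0 z * K z)"
      by (simp only: of_real_diff left_diff_distrib)
    finally have "norm (LINT z|lborel. of_real (f z) * K z) \<le>
        (LINT z|lborel. norm (of_real (F z - u z) * e 1 0 z * K z))"
      by (simp only: integral_norm_bound)
    also have "\<dots> \<le> (LINT z|lborel. \<epsilon> * norm (e 1 0 z * K z))"
    proof (rule integral_mono)
      show "integrable lborel (\<lambda>z. norm (of_real (F z - u z) * e 1 0 z * K z))"
        by (intro integrable_norm int continuous_intros F uc)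
      show "integrable lborel (\<lambda>z. \<epsilon> * norm (e 1 0 z * K z))"
        by (intro integrable_mult_right integrable_norm int continuous_intros)
      show "norm (of_real (F z - u z) * e 1 0 z * K z) \<le> \<epsilon> * norm (e 1 0 z * K z)" for z
      proof (cases "z \<in> S")
        case True
        then have "\<bar>F z - u z\<bar> * norm (e 1 0 z * K z) \<le> \<epsilon> * norm (e 1 0 z * K z)"
          using u(2)[OF True] by (intro mult_right_mono) simp_all
        then show ?thesis by (simp only: norm_mult mult.assoc norm_of_real)
      qed (simp add: K(2) S_def)
    qed
    finally show ?thesis by (simp add: C_def)
  qed
  moreover have "((\<lambda>\<epsilon>. \<epsilon> * C) \<longlongrightarrow> 0 * C) (at_right 0)" by (intro tendsto_intros)
  ultimately have "norm (LINT z|lborel. of_real (f z) * K z) \<le> 0"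
    by (intro tendsto_lowerbound[of "\<lambda>\<epsilon>. \<epsilon> * C" _ "at_right 0"])
      (auto intro: eventually_mono[OF eventually_at_right_less])
  then show ?thesis by simp
qed

section \<open>Recovery of a function up to a phase\<close>

text \<open>Equal moduli mean that the difference of two rank-one kernels is orthogonal to the
  exponentials, hence to all real continuous functions. A rank-one kernel
  \<open>h x * cnj (h y)\<close> determines \<open>h\<close> up to a unimodular factor.\<close>

lemma unimodular_multiple_if_local_spectra_eq:
  fixes h h' :: "real \<Rightarrow> complex" and m B :: real
  defines "E \<equiv> \<lambda>(n::nat) (k::int) t. exp (of_real (2 * real n * t) - \<i> * of_real (m * of_int k * t))"
  assumes h: "integrable lborel h" "\<And>t. t \<notin> {-B..B} \<Longrightarrow> h t = 0"
    and h': "integrable lborel h'" "\<And>t. t \<notin> {-B..B} \<Longrightarrow> h' t = 0"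
    and m: "0 < m" "m * (4 * B) < 2 * pi"
    and eq: "\<And>n k. 1 \<le> n \<Longrightarrow> norm (LINT t|lborel. E n k t * h t) = norm (LINT t|lborel. E n k t * h' t)"
  shows "\<exists>c. norm c = 1 \<and> (AE t in lborel. h t = c * h' t)"
proof -
  define K where "K z = h (fst z) * cnj (h (snd z)) - h' (fst z) * cnj (h' (snd z))" for z
  have cnj_int: "integrable lborel (\<lambda>t. cnj (w t))" if "integrable lborel w" for w :: "real \<Rightarrow> complex"
    using that by simp
  have int: "integrable lborel (\<lambda>t. q t * h t)" "integrable lborel (\<lambda>t. q t * h' t)"
    if "continuous_on UNIV q" for q
    using integrable_continuous_mult_compact[OF h(1) _ _ that, of "{-B..B}"] h(2)
      integrable_continuous_mult_compact[OF h'(1) _ _ that, of "{-B..B}"] h'(2) by auto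
  \<comment> \<open>By Fubini, a product tested against \<open>K\<close> yields a difference of
    sesquilinear forms. This is used both for exponentials and for real test functions.\<close>
  have tensor: "(LINT z|lborel. p (fst z) * cnj (q (snd z)) * K z) =
      (LINT t|lborel. p t * h t) * cnj (LINT t|lborel. q t * h t)
      - (LINT t|lborel. p t * h' t) * cnj (LINT t|lborel. q t * h' t)"
    if p: "continuous_on UNIV p" and q: "continuous_on UNIV q" for p q
  proof -
    have split: "p (fst z) * cnj (q (snd z)) * K z =
       (p (fst z) * h (fst z)) * cnj (q (snd z) * h (snd z))
       - (p (fst z) * h' (fst z)) * cnj (q (snd z) * h' (snd z))" for z
      by (simp add: K_def algebra_simps)
    note I = integrable_tensor_lborel[OF int(1)[OF p] cnj_int[OF int(1)[OF q]]]
      integrable_tensor_lborel[OF int(2)[OF p] cnj_int[OF int(2)[OF q]]]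
    show ?thesis
      unfolding split Bochner_Integration.integral_diff[OF I]
        integral_tensor_lborel[OF int(1)[OF p] cnj_int[OF int(1)[OF q]]]
        integral_tensor_lborel[OF int(2)[OF p] cnj_int[OF int(2)[OF q]]] Bochner_Integration.integral_cnj ..
  qed
  have K0: "(LINT z|lborel. of_real (f z) * K z) = 0" if f: "continuous_on UNIV f" for f
  proof (rule integral_continuous_mult_eq_0[OF _ _ m _ f])
    show "integrable lborel K"
      unfolding K_def
      by (intro Bochner_Integration.integrable_diff integrable_tensor_lborel cnj_int h h')
    show "K z = 0" if "z \<notin> {-B..B} \<times> {-B..B}" for z
      using that h(2)[of "fst z"] h(2)[of "snd z"] h'(2)[of "fst z"] h'(2)[of "snd z"]
      unfolding K_def mem_Times_iff by fastforce
    fix n :: nat and k :: int assume n: "1 \<le> n"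
    have E: "continuous_on UNIV (E n k)" unfolding E_def by (intro continuous_intros)
    \<comment> \<open>Conjugation in the second variable keeps the real part of the exponent and
      flips the imaginary part, hence the sum and the difference of the coordinates. With both
      factors equal to \<open>E n k\<close>, \<open>tensor\<close> becomes a difference of squared
      moduli.\<close>
    have "exp (of_real (2 * real n * (fst z + snd z)) - \<i> * of_real (m * of_int k * (fst z - snd z)))
        = E n k (fst z) * cnj (E n k (snd z))" for z
      by (simp add: E_def exp_cnj exp_add[symmetric] algebra_simps)
    then have "(LINT z|lborel. exp (of_real (2 * real n * (fst z + snd z))
        - \<i> * of_real (m * of_int k * (fst z - snd z))) * K z)
        = (LINT z|lborel. E n k (fst z) * cnj (E n k (snd z)) * K z)" by presburger
    also have "\<dots> = 0"
      using eq[OF n, of k] by (simp only: tensor[OF E E] complex_norm_square[symmetric]) simp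
    finally show "(LINT z|lborel. exp (of_real (2 * real n * (fst z + snd z))
        - \<i> * of_real (m * of_int k * (fst z - snd z))) * K z) = 0" .
  qed
  define L where "L w \<phi> = (LINT t|lborel. \<phi> t *\<^sub>R w t)" for w :: "real \<Rightarrow> complex" and \<phi> :: "real \<Rightarrow> real"
  have bilin: "L h \<phi> * cnj (L h \<psi>) = L h' \<phi> * cnj (L h' \<psi>)"
    if "continuous_on UNIV \<phi>" "continuous_on UNIV \<psi>" for \<phi> \<psi>
  proof -
    have "continuous_on UNIV (\<lambda>z::real\<times>real. \<phi> (fst z) * \<psi> (snd z))"
      by (intro continuous_intros continuous_on_compose2[OF that(1)] continuous_on_compose2[OF that(2)]) auto
    from K0[OF this]
    have "(LINT z|lborel. of_real (\<phi> (fst z)) * cnj (of_real (\<psi> (snd z))) * K z) = 0"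
      by simp
    then show ?thesis
      using tensor[of "\<lambda>t. of_real (\<phi> t)" "\<lambda>t. of_real (\<psi> t)"] that
      by (simp add: L_def scaleR_conv_of_real continuous_on_of_real)
  qed
  have "\<exists>c. norm c = 1 \<and> (\<forall>\<phi>. continuous_on UNIV \<phi> \<longrightarrow> L h \<phi> = c * L h' \<phi>)"
  proof (cases "\<forall>\<phi>. continuous_on UNIV \<phi> \<longrightarrow> L h \<phi> = 0")
    case True
    \<comment> \<open>On the diagonal \<open>bilin\<close> says that \<open>L h \<phi>\<close> and
      \<open>L h' \<phi>\<close> have equal moduli, so both functionals vanish and any unimodular
      constant serves.\<close>
    then have "L h' \<phi> = 0" if "continuous_on UNIV \<phi>" for \<phi>
      using bilin[OF that that] that by simp
    then show ?thesis using True by (intro exI[of _ 1]) simp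
  next
    case False
    then obtain \<psi> where \<psi>: "continuous_on UNIV \<psi>" "L h \<psi> \<noteq> 0" by blast
    have "of_real ((norm (L h \<psi>))\<^sup>2) = (of_real ((norm (L h' \<psi>))\<^sup>2) :: complex)"
      using bilin[OF \<psi>(1) \<psi>(1)] by (simp only: complex_norm_square)
    then have "norm (L h \<psi>) = norm (L h' \<psi>)" by (simp only: of_real_eq_iff) simp
    \<comment> \<open>Dividing \<open>bilin\<close> by the nonzero \<open>cnj (L h \<psi>)\<close>
      gives a factor independent of \<open>\<phi>\<close>; the equality of norms makes it
      unimodular.\<close>
    then show ?thesis
      using bilin[OF _ \<psi>(1)] \<psi>(2)
      by (intro exI[of _ "cnj (L h' \<psi>) / cnj (L h \<psi>)"]) (auto simp: norm_divide field_simps)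
  qed
  then obtain c where c: "norm c = 1" "\<And>\<phi>. continuous_on UNIV \<phi> \<Longrightarrow> L h \<phi> = c * L h' \<phi>"
    by blast
  have "AE t in lborel. h t - c * h' t = 0"
  proof (rule AE_zero_if_continuous_tests_zero)
    fix \<phi> :: "real \<Rightarrow> real" assume \<phi>: "continuous_on UNIV \<phi>"
    then have I: "integrable lborel (\<lambda>t. \<phi> t *\<^sub>R h t)" "integrable lborel (\<lambda>t. c * (\<phi> t *\<^sub>R h' t))"
      using int[of "\<lambda>t. of_real (\<phi> t)"] by (auto simp: scaleR_conv_of_real continuous_on_of_real)
    have "(LINT t|lborel. \<phi> t *\<^sub>R (h t - c * h' t)) = (LINT t|lborel. \<phi> t *\<^sub>R h t - c * (\<phi> t *\<^sub>R h' t))"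
      by (simp add: scaleR_diff_right)
    also have "\<dots> = L h \<phi> - c * L h' \<phi>"
      unfolding Bochner_Integration.integral_diff[OF I] by (simp only: L_def integral_mult_right_zero)
    finally show "(LINT t|lborel. \<phi> t *\<^sub>R (h t - c * h' t)) = 0" using c(2)[OF \<phi>] by simp
  qed (use h h' in auto)
  then show ?thesis using c by auto
qed

section \<open>From transform samples to exponential integrals\<close>

text \<open>On a bounded interval \<open>x \<le> 1 + x powr p\<close> embeds the p-integrable
  functions into the integrable ones.\<close>

lemma integrable_zero_ext:
  assumes f: "f \<in> Lp_on p {-B..B}" and p: "1 \<le> p"
  shows "integrable lebesgue (zero_ext {-B..B} f)"
proof -
  have zero_ext_eq: "zero_ext {-B..B} f = (\<lambda>t. indicator {-B..B} t *\<^sub>R f t)"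
    by (auto simp: zero_ext_def)
  have bound: "x \<le> 1 + x powr p" if "0 \<le> x" for x :: real
  proof (cases "x \<le> 1")
    case True
    then show ?thesis using powr_ge_zero[of x p] by linarith
  next
    case False
    then show ?thesis using powr_mono[of 1 p x] p by simp
  qed
  have "integrable lebesgue (\<lambda>t. indicator {-B..B} t + indicator {-B..B} t *\<^sub>R (norm (f t) powr p))"
    using f by (intro Bochner_Integration.integrable_add)
      (auto simp: Lp_on_def set_integrable_def intro!: integrable_real_indicator emeasure_lborel_cbox_finite[of "-B" B, simplified])
  then show ?thesis
    using f bound unfolding zero_ext_eq
    by (elim Bochner_Integration.integrable_bound)
      (auto simp: Lp_on_def set_borel_measurable_def indicator_def intro!: AE_I2)
qed

text \<open>The transform integrates over \<open>lebesgue\<close>, whereas the Fubini and density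
  arguments run over \<open>lborel\<close>. Cutting the Borel version off by the indicator of
  \<open>S\<close> makes it vanish at every point outside \<open>S\<close>, not just almost
  everywhere.\<close>

lemma lborel_representative:
  fixes w :: "real \<Rightarrow> complex"
  assumes w: "integrable lebesgue w" and S: "S \<in> sets borel" "\<And>t. t \<notin> S \<Longrightarrow> w t = 0"
  obtains w' where "integrable lborel w'" "\<And>t. t \<notin> S \<Longrightarrow> w' t = 0" "AE t in lebesgue. w t = w' t"
proof -
  have [measurable]: "w \<in> borel_measurable lebesgue" using w by simp
  have "(\<lambda>t. Re (w t)) \<in> borel_measurable lebesgue" "(\<lambda>t. Im (w t)) \<in> borel_measurable lebesgue"
    by measurable
  from this[THEN completion_ex_borel_measurable_real]
  obtain r i where ri: "r \<in> borel_measurable lborel" "i \<in> borel_measurable lborel"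
      and ae: "AE t in lborel. Re (w t) = r t" "AE t in lborel. Im (w t) = i t"
    by auto
  define w' where "w' t = indicator S t *\<^sub>R Complex (r t) (i t)" for t
  have [measurable]: "w' \<in> borel_measurable lborel"
    unfolding w'_def Complex_eq using ri S by measurable
  from ae have "AE t in lborel. w t = w' t"
    by eventually_elim (auto simp: w'_def complex_eq_iff S indicator_def)
  then have eq: "AE t in lebesgue. w t = w' t" by (rule AE_completion)
  have "integrable lebesgue w'"
    using integrable_cong_AE[THEN iffD1, OF _ _ eq w] by (simp add: measurable_completion)
  then have "integrable lborel w'" by (simp add: integrable_completion)
  moreover have "w' t = 0" if "t \<notin> S" for t using that by (simp add: w'_def)
  ultimately show thesis using eq that by blast
qed

text \<open>Expanding \<open>(t - n)^2\<close> splits the window into \<open>exp (- n^2)\<close>,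
  \<open>exp (2 n t)\<close> and \<open>exp (- t^2)\<close>, and at \<open>\<mu> = m b k\<close> the
  factor \<open>1 / b\<close> cancels from the phase. The chirp in \<open>d\<close> is free of
  \<open>t\<close> and unimodular; the chirp in \<open>a\<close> and \<open>exp (- t^2)\<close> are
  the same for all samples and are absorbed into the function.\<close>

lemma gabor_lct_eq:
  assumes b: "b \<noteq> 0" and w: "w \<in> borel_measurable lebesgue" "w' \<in> borel_measurable lborel"
    and eq: "AE t in lebesgue. w t = w' t"
  shows "norm (gabor_lct (a, b, c, d) w (real n) (m * b * of_int k)) =
    norm (1 / csqrt (of_real b)) * exp (- (real n)\<^sup>2) *
    norm (LINT t|lborel. exp (of_real (2 * real n * t) - \<i> * of_real (m * of_int k * t))
      * (exp (\<i> * of_real (a / (2 * b) * t\<^sup>2) - of_real (t\<^sup>2)) * w' t))"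
proof -
  define \<mu> where "\<mu> = m * b * of_int k"
  define C where "C = exp (\<i> * of_real (d / (2 * b) * \<mu>\<^sup>2)) * of_real (exp (- (real n)\<^sup>2))"
  define G where "G t = exp (\<i> * of_real (a / (2 * b) * t\<^sup>2 - 1 / b * t * \<mu> + d / (2 * b) * \<mu>\<^sup>2))
        * cnj (gauss_window (t - real n))" for t
  have "continuous_on UNIV G"
    unfolding G_def gauss_window_def by (intro continuous_intros)
  then have G[measurable]: "G \<in> borel_measurable borel" by (rule borel_measurable_continuous_onI)
  have G_eq: "G t = C * (exp (of_real (2 * real n * t) - \<i> * of_real (m * of_int k * t))
      * exp (\<i> * of_real (a / (2 * b) * t\<^sup>2) - of_real (t\<^sup>2)))" for t
  proof -
    have "1 / b * t * \<mu> = m * of_int k * t" using b by (simp add: \<mu>_def)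
    then have "\<i> * of_real (a / (2 * b) * t\<^sup>2 - 1 / b * t * \<mu> + d / (2 * b) * \<mu>\<^sup>2)
          + of_real (- (t - real n)\<^sup>2) =
        \<i> * of_real (d / (2 * b) * \<mu>\<^sup>2) + of_real (- (real n)\<^sup>2)
        + ((of_real (2 * real n * t) - \<i> * of_real (m * of_int k * t))
          + (\<i> * of_real (a / (2 * b) * t\<^sup>2) - of_real (t\<^sup>2)))"
      by (simp add: complex_eq_iff power2_diff)
    then show ?thesis
      unfolding G_def C_def gauss_window_def complex_cnj_complex_of_real
      unfolding exp_of_real[symmetric] exp_add[symmetric] by presburger
  qed
  have "(LINT t|lebesgue. G t * w t) = (LINT t|lebesgue. G t * w' t)"
    using w eq G by (intro integral_cong_AE borel_measurable_times)
      (auto simp: measurable_completion)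
  also have "\<dots> = (LINT t|lborel. G t * w' t)"
    using w by (intro integral_completion) auto
  finally have "gabor_lct (a, b, c, d) w (real n) \<mu> = 1 / csqrt (of_real b) * (LINT t|lborel. G t * w' t)"
    by (simp only: gabor_lct_def stlct_def G_def prod.case)
  also have "(LINT t|lborel. G t * w' t) =
      C * (LINT t|lborel. exp (of_real (2 * real n * t) - \<i> * of_real (m * of_int k * t))
      * (exp (\<i> * of_real (a / (2 * b) * t\<^sup>2) - of_real (t\<^sup>2)) * w' t))"
    by (simp only: G_eq mult.assoc integral_mult_right_zero)
  finally show ?thesis
    unfolding \<mu>_def[symmetric]
    by (simp only: norm_mult C_def norm_exp_i_times norm_of_real abs_exp_cancel
      mult_1 mult.assoc)
qed

section \<open>The equivalence for the sampled transform\<close>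

theorem theorem1p3:
  fixes a b c d p B m :: real
    and f g :: "real \<Rightarrow> complex"
  assumes "a * d - b * c = 1" and "b \<noteq> 0"
    and "1 \<le> p" and "0 < B" and "m \<in> {0<..<1 / (4 * B)}"
    and "f \<in> Lp_on p {-B..B}" and "g \<in> Lp_on p {-B..B}"
  shows "(\<exists>\<alpha>::real. AE t in lebesgue. t \<in> {-B..B} \<longrightarrow> f t = exp (\<i> * of_real \<alpha>) * g t)
    \<longleftrightarrow> (\<forall>(x, \<mu>) \<in> (real ` {1::nat..}) \<times> range (\<lambda>k::int. m * b * of_int k).
          norm (gabor_lct (a, b, c, d) (zero_ext {-B..B} f) x \<mu>)
          = norm (gabor_lct (a, b, c, d) (zero_ext {-B..B} g) x \<mu>))"
    (is "?same \<longleftrightarrow> ?samples")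
proof -
  let ?f = "zero_ext {-B..B} f" and ?g = "zero_ext {-B..B} g"
  have int: "integrable lebesgue ?f" "integrable lebesgue ?g"
    using integrable_zero_ext assms by blast+
  obtain f' where f': "integrable lborel f'" "\<And>t. t \<notin> {-B..B} \<Longrightarrow> f' t = 0" "AE t in lebesgue. ?f t = f' t"
    by (rule lborel_representative[OF int(1), of "{-B..B}"]) (auto simp: zero_ext_def)
  obtain g' where g': "integrable lborel g'" "\<And>t. t \<notin> {-B..B} \<Longrightarrow> g' t = 0" "AE t in lebesgue. ?g t = g' t"
    by (rule lborel_representative[OF int(2), of "{-B..B}"]) (auto simp: zero_ext_def)
  define \<gamma> where "\<gamma> t = exp (\<i> * of_real (a / (2 * b) * t\<^sup>2) - of_real (t\<^sup>2))" for t :: real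
  \<comment> \<open>The prefactor from \<open>gabor_lct_eq\<close> is common to both sides and
    nonzero, since \<open>csqrt\<close> of a nonzero number is nonzero; it cancels.\<close>
  have samples_iff: "?samples \<longleftrightarrow> (\<forall>n k. 1 \<le> n \<longrightarrow>
      norm (LINT t|lborel. exp (of_real (2 * real n * t) - \<i> * of_real (m * of_int k * t)) * (\<gamma> t * f' t)) =
      norm (LINT t|lborel. exp (of_real (2 * real n * t) - \<i> * of_real (m * of_int k * t)) * (\<gamma> t * g' t)))"
    using gabor_lct_eq[OF \<open>b \<noteq> 0\<close> _ _ f'(3)] gabor_lct_eq[OF \<open>b \<noteq> 0\<close> _ _ g'(3)] int f'(1) g'(1) \<open>b \<noteq> 0\<close>
    by (auto simp: \<gamma>_def)
  show ?thesis
  proof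
    assume ?same
    then obtain \<alpha> :: real where \<alpha>: "AE t in lebesgue. t \<in> {-B..B} \<longrightarrow> f t = exp (\<i> * of_real \<alpha>) * g t"
      by blast
    \<comment> \<open>The assumption speaks only of the interval; outside it both zero extensions
      vanish.\<close>
    from \<alpha> f'(3) g'(3) have "AE t in lebesgue. f' t = exp (\<i> * of_real \<alpha>) * g' t"
    proof eventually_elim
      case (elim t)
      then show ?case by (cases "t \<in> {-B..B}") (auto simp: zero_ext_def)
    qed
    then have ae: "AE t in lborel. f' t = exp (\<i> * of_real \<alpha>) * g' t"
      by (simp add: AE_completion_iff)
    have [measurable]: "\<gamma> \<in> borel_measurable borel" "f' \<in> borel_measurable borel" "g' \<in> borel_measurable borel"
      using f'(1) g'(1) unfolding \<gamma>_def
      by (auto intro!: borel_measurable_continuous_onI continuous_intros)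
    have "(LINT t|lborel. e t * (\<gamma> t * f' t)) = (LINT t|lborel. exp (\<i> * of_real \<alpha>) * (e t * (\<gamma> t * g' t)))"
      if [measurable]: "e \<in> borel_measurable borel" for e
      by (rule integral_cong_AE) (use ae in auto)
    then have "norm (LINT t|lborel. e t * (\<gamma> t * f' t)) = norm (LINT t|lborel. e t * (\<gamma> t * g' t))"
      if "e \<in> borel_measurable borel" for e
      using that by (simp add: norm_mult)
    then show ?samples
      unfolding samples_iff by (auto intro!: borel_measurable_continuous_onI continuous_intros)
  next
    assume ?samples
    have \<gamma>: "continuous_on UNIV \<gamma>" unfolding \<gamma>_def by (intro continuous_intros)
    have "m * (4 * B) < 1" using assms by (simp add: field_simps)
    then have m: "0 < m" "m * (4 * B) < 2 * pi" using assms(5) pi_gt3 by (simp, linarith)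
    have "\<exists>c. norm c = 1 \<and> (AE t in lborel. \<gamma> t * f' t = c * (\<gamma> t * g' t))"
    proof (rule unimodular_multiple_if_local_spectra_eq[OF _ _ _ _ m])
      show "integrable lborel (\<lambda>t. \<gamma> t * f' t)" "integrable lborel (\<lambda>t. \<gamma> t * g' t)"
        using integrable_continuous_mult_compact[OF f'(1) compact_Icc f'(2) \<gamma>]
          integrable_continuous_mult_compact[OF g'(1) compact_Icc g'(2) \<gamma>] by auto
    qed (use samples_iff[THEN iffD1, OF \<open>?samples\<close>] f'(2) g'(2) in auto)
    then obtain c where c: "norm c = 1" "AE t in lborel. \<gamma> t * f' t = c * (\<gamma> t * g' t)" by blast
    have "AE t in lebesgue. \<gamma> t * f' t = c * (\<gamma> t * g' t)" using c(2) by (rule AE_completion)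
    \<comment> \<open>The weight \<open>\<gamma>\<close> is an exponential, hence nowhere zero, and
      can be cancelled.\<close>
    then have "AE t in lebesgue. t \<in> {-B..B} \<longrightarrow> f t = c * g t"
      using f'(3) g'(3) by eventually_elim (auto simp: zero_ext_def \<gamma>_def)
    moreover have "c = exp (\<i> * of_real (Arg c))"
      using c(1) cis_Arg[of c] by (cases "c = 0") (simp_all add: cis_conv_exp sgn_div_norm)
    ultimately show ?same by metis
  qed
qed

end
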